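(* Let $X$ be a finite connected simplicial complex, let $X'$ be a connected subcomplex of $X$, and let $k \geq 1$. Then $$\mu_k(X') \geq \mu_k(X) - (k+2)\, S_k(X,X'),$$ where $\mu_k(\cdot)$ denotes the minimal eigenvalue of the reduced $k$-Laplacian and $$S_k(X,X') := \max_{\sigma \in X'(k)} \left|\{\tau \in X(k+1)\setminus X'(k+1) \ : \ \sigma \subset \tau\}\right|.$$
   Context: Simplicial complexes are finite abstract simplicial complexes. For a simplicial complex $Y$, each simplex is given an arbitrary fixed orientation and $Y(k)$ denotes the set of $k$-dimensional (oriented) simplices of $Y$ (one per underlying $k$-simplex). A complex $Y$ is connected if its $1$-skeleton $G_Y$ (the graph whose vertices are the $0$-simplices and whose edges are the $1$-simplices of $Y$) is connected. $C^k(Y;\mathbb{R})$ is the space of real-valued $k$-cochains of $Y$ for $k\ge 0$ (alternating under change of orientation), with $C^{-1}(Y;\mathbb{R})=\mathbb{R}$. The coboundary operator $\delta_k(Y): C^k(Y;\mathbb{R})\to C^{k+1}(Y;\mathbb{R})$ is $\delta_k(Y)\phi([v_0,\dots,v_{k+1}])=\sum_{j=0}^{k+1}(-1)^j\phi([v_0,\dots,\widehat{v_j},\dots,v_{k+1}])$ for $k\ge 0$, and $\delta_{-1}(Y)(x)(v)=x$ for $x\in\mathbb{R}$ and every vertex $v$. Each $C^k(Y;\mathbb{R})$ carries the inner product $\langle\phi,\psi\rangle=\sum_{\sigma\in Y(k)}\phi(\sigma)\psi(\sigma)$ (for $k=-1$, the usual product on $\mathbb{R}$), and $\delta_k^*(Y)$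 is the adjoint of $\delta_k(Y)$. For $k\ge 0$, the reduced $k$-Laplacian is $\Delta_k(Y)=\delta_{k-1}(Y)\delta_{k-1}^*(Y)+\delta_k^*(Y)\delta_k(Y)$ on $C^k(Y;\mathbb{R})$, and $\mu_k(Y)$ is its minimal eigenvalue (defined when $Y$ has at least one $k$-simplex, so the inequality is understood for $X'(k)\neq\emptyset$). *)

theory Defs
  imports Complex_Main "HOL-Combinatorics.Permutations"
begin

text \<open>
  A finite abstract simplicial complex is given by its set of (nonempty) simplices. Cochains are
  alternating functions on ordered simplices, i.e. on vertex lists without repetition. The degree
  \<open>k\<close> ranges over the integers, so that \<open>k = -1\<close> is covered: the empty set is the only simplex of
  dimension \<open>-1\<close>, hence a cochain of degree \<open>-1\<close> is a single real number (its value at \<open>[]\<close>).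
\<close>

definition simplicial_complex :: "'a set set \<Rightarrow> bool" where
  "simplicial_complex Y \<longleftrightarrow>
     finite Y \<and>
     (\<forall>\<sigma>\<in>Y. finite \<sigma> \<and> \<sigma> \<noteq> {}) \<and>
     (\<forall>\<sigma>\<in>Y. \<forall>\<tau>. \<tau> \<noteq> {} \<longrightarrow> \<tau> \<subseteq> \<sigma> \<longrightarrow> \<tau> \<in> Y)"

definition subcomplex :: "'a set set \<Rightarrow> 'a set set \<Rightarrow> bool" where
  "subcomplex X' X \<longleftrightarrow> simplicial_complex X' \<and> X' \<subseteq> X"

definition skeleton_edges :: "'a set set \<Rightarrow> ('a \<times> 'a) set" where
  "skeleton_edges Y = {(u, v). u \<noteq> v \<and> {u, v} \<in> Y}"

definition connected_complex :: "'a set set \<Rightarrow> bool" where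
  "connected_complex Y \<longleftrightarrow>
     (\<forall>u v. {u} \<in> Y \<longrightarrow> {v} \<in> Y \<longrightarrow> (u, v) \<in> (skeleton_edges Y)\<^sup>*)"

definition simplices :: "'a set set \<Rightarrow> int \<Rightarrow> 'a set set" where
  "simplices Y k = {\<sigma> \<in> insert {} Y. int (card \<sigma>) = k + 1}"

definition ordered_simplices :: "'a set set \<Rightarrow> int \<Rightarrow> 'a list set" where
  "ordered_simplices Y k = {xs. distinct xs \<and> set xs \<in> simplices Y k}"

text \<open>An orientation of a simplex is fixed by choosing one ordering of its vertices.\<close>

definition orientation :: "'a set set \<Rightarrow> ('a set \<Rightarrow> 'a list) \<Rightarrow> bool" where
  "orientation Y ori \<longleftrightarrow> (\<forall>\<sigma>\<in>insert {} Y. distinct (ori \<sigma>) \<and> set (ori \<sigma>) = \<sigma>)"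

text \<open>
  Cochains are extended by \<open>0\<close> to lists that are not ordered simplices, so that equality of
  cochains is equality of functions.
\<close>

definition cochains :: "'a set set \<Rightarrow> int \<Rightarrow> ('a list \<Rightarrow> real) set" where
  "cochains Y k = {\<phi>.
     (\<forall>xs. xs \<notin> ordered_simplices Y k \<longrightarrow> \<phi> xs = 0) \<and>
     (\<forall>xs\<in>ordered_simplices Y k. \<forall>p. p permutes {..<length xs} \<longrightarrow>
        \<phi> (permute_list p xs) = of_int (sign p) * \<phi> xs)}"

definition coboundary :: "'a set set \<Rightarrow> int \<Rightarrow> ('a list \<Rightarrow> real) \<Rightarrow> 'a list \<Rightarrow> real" where
  "coboundary Y k \<phi> xs =
     (if xs \<in> ordered_simplices Y (k + 1)
      then \<Sum>j<length xs. (-1) ^ j * \<phi> (take j xs @ drop (Suc j) xs)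
      else 0)"

definition cochain_inner ::
  "('a set \<Rightarrow> 'a list) \<Rightarrow> 'a set set \<Rightarrow> int \<Rightarrow> ('a list \<Rightarrow> real) \<Rightarrow> ('a list \<Rightarrow> real) \<Rightarrow> real" where
  "cochain_inner ori Y k \<phi> \<psi> = (\<Sum>\<sigma>\<in>simplices Y k. \<phi> (ori \<sigma>) * \<psi> (ori \<sigma>))"

definition coboundary_adjoint ::
  "('a set \<Rightarrow> 'a list) \<Rightarrow> 'a set set \<Rightarrow> int \<Rightarrow> ('a list \<Rightarrow> real) \<Rightarrow> 'a list \<Rightarrow> real" where
  "coboundary_adjoint ori Y k \<psi> =
     (THE \<chi>. \<chi> \<in> cochains Y k \<and>
        (\<forall>\<phi>\<in>cochains Y k.
           cochain_inner ori Y (k + 1) (coboundary Y k \<phi>) \<psi> = cochain_inner ori Y k \<phi> \<chi>))"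

definition laplacian ::
  "('a set \<Rightarrow> 'a list) \<Rightarrow> 'a set set \<Rightarrow> int \<Rightarrow> ('a list \<Rightarrow> real) \<Rightarrow> 'a list \<Rightarrow> real" where
  "laplacian ori Y k \<phi> = (\<lambda>xs.
     coboundary Y (k - 1) (coboundary_adjoint ori Y (k - 1) \<phi>) xs +
     coboundary_adjoint ori Y k (coboundary Y k \<phi>) xs)"

definition laplacian_eigenvalue ::
  "('a set \<Rightarrow> 'a list) \<Rightarrow> 'a set set \<Rightarrow> int \<Rightarrow> real \<Rightarrow> bool" where
  "laplacian_eigenvalue ori Y k c \<longleftrightarrow>
     (\<exists>\<phi>\<in>cochains Y k. \<phi> \<noteq> (\<lambda>_. 0) \<and> laplacian ori Y k \<phi> = (\<lambda>xs. c * \<phi> xs))"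

text \<open>Meaningful only if \<open>Y\<close> has a \<open>k\<close>-simplex: otherwise there is no eigenvalue.\<close>

definition min_eigenvalue :: "('a set \<Rightarrow> 'a list) \<Rightarrow> 'a set set \<Rightarrow> int \<Rightarrow> real" where
  "min_eigenvalue ori Y k = (LEAST c. laplacian_eigenvalue ori Y k c)"

definition max_missing_cofaces :: "int \<Rightarrow> 'a set set \<Rightarrow> 'a set set \<Rightarrow> nat" where
  "max_missing_cofaces k X X' =
     Max ((\<lambda>\<sigma>. card {\<tau> \<in> simplices X (k + 1) - simplices X' (k + 1). \<sigma> \<subset> \<tau>}) ` simplices X' k)"

end

theory Submission imports Defs "HOL-Analysis.Function_Topology" "HOL-Analysis.Convex" begin

text \<open>
The smallest eigenvalue of the Laplacian on a finite-dimensional inner product space is the minimum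
of its Rayleigh quotient (\<open>min_eigenvalue_rayleigh\<close>), here the quotient of
\<open>\<parallel>\<delta>\<^sup>*\<phi>\<parallel>\<^sup>2 + \<parallel>\<delta>\<phi>\<parallel>\<^sup>2\<close> by \<open>\<parallel>\<phi>\<parallel>\<^sup>2\<close>. It is therefore enough to extend a minimising cochain \<open>\<phi>\<close> of the
subcomplex by zero to the whole complex and to see how much the quotient can grow.

Since cochains already vanish on every list that is not an ordered simplex of their complex,
extension by zero does not change the function \<open>\<phi>\<close> at all; it is merely regarded as a cochain of
\<open>X\<close>. Its norm is the same in both complexes. So is the norm of \<open>\<delta>\<^sup>*\<phi>\<close>: its value at a face is a sum
of values of \<open>\<phi>\<close> over cofaces, and if a coface belongs to \<open>X'\<close> then so does the face
(\<open>coboundary_transpose_extend_by_zero\<close>). The norm of \<open>\<delta>\<phi>\<close> gains only the contributions of the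
\<open>(k+1)\<close>-simplices \<open>\<tau>\<close> missing from \<open>X'\<close>. Such a \<open>\<tau>\<close> has \<open>k + 2\<close> facets, so by the Cauchy-Schwarz
inequality it contributes at most \<open>k + 2\<close> times the sum of \<open>\<phi>(\<sigma>)\<^sup>2\<close> over its facets \<open>\<sigma>\<close>
(\<open>coboundary_square_le\<close>). Exchanging the two summations, each \<open>\<phi>(\<sigma>)\<^sup>2\<close> is counted once for every
missing coface of \<open>\<sigma>\<close>, that is, at most \<open>max_missing_cofaces k X X'\<close> times
(\<open>dirichlet_form_extend_by_zero\<close>).

Two things have to be made explicit for this. The adjoint of the coboundary is characterised
abstractly, and the argument needs the formula \<open>(\<delta>\<^sup>*\<psi>)(\<sigma>) = \<Sum>v. \<psi>(v\<sigma>)\<close> (\<open>coboundary_adjoint_eq\<close>). And the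
minimum of the Rayleigh quotient has to be attained: the unit sphere of cochains is compact in the
product topology on functions, and the first variation at a minimiser says that it is an
eigenvector.
\<close>

section \<open>The sign relating two orderings of a simplex\<close>

text \<open>
Alternating functions are handled through the sign by which two orderings of the same vertices
differ, which hides the index permutations. It is multiplicative along chains of orderings,
symmetric, and unchanged by a common first vertex.
\<close>

definition list_sign :: "'a list \<Rightarrow> 'a list \<Rightarrow> int" where
  "list_sign xs ys = sign (THE p. p permutes {..<length xs} \<and> permute_list p xs = ys)"

lemma list_sign_permute_list:
  assumes "distinct xs" and p: "p permutes {..<length xs}"
  shows "list_sign xs (permute_list p xs) = sign p"
proof -
  have "q = p" if q: "q permutes {..<length xs}" "permute_list q xs = permute_list p xs" for q
  proof
    fix i
    show "q i = p i"
    proof (cases "i < length xs")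
      case True
      then have "xs ! q i = xs ! p i"
        using q p permute_list_nth by metis
      moreover have "q i < length xs" "p i < length xs"
        using permutes_in_image[OF p, of i] permutes_in_image[OF q(1), of i] True by auto
      ultimately show ?thesis
        using \<open>distinct xs\<close> by (simp add: nth_eq_iff_index_eq)
    next
      case False
      then show ?thesis
        using permutes_not_in[OF p] permutes_not_in[OF q(1)] by simp
    qed
  qed
  then have "(THE q. q permutes {..<length xs} \<and> permute_list q xs = permute_list p xs) = p"
    using p by blast
  then show ?thesis
    by (simp add: list_sign_def)
qed

lemma obtain_permute_list:
  assumes "distinct xs" "distinct ys" "set xs = set ys"
  obtains p where "p permutes {..<length xs}" "permute_list p xs = ys"
  using assms mset_eq_permutation set_eq_iff_mset_eq_distinct by metis

lemma list_sign_self: "distinct xs \<Longrightarrow> list_sign xs xs = 1"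
  using list_sign_permute_list[of xs id] permutes_id by simp

lemma list_sign_trans:
  assumes "distinct xs" "distinct ys" "distinct zs" "set xs = set ys" "set ys = set zs"
  shows "list_sign xs zs = list_sign xs ys * list_sign ys zs"
proof -
  obtain p where p: "p permutes {..<length xs}" "permute_list p xs = ys"
    using assms by (rule_tac obtain_permute_list[of xs ys]) auto
  obtain q where q: "q permutes {..<length ys}" "permute_list q ys = zs"
    using assms by (rule_tac obtain_permute_list[of ys zs]) auto
  have q': "q permutes {..<length xs}"
    using p(2) q(1) by auto
  have "permute_list (p \<circ> q) xs = zs"
    using permute_list_compose[OF q'] p q by metis
  then have "list_sign xs zs = sign (p \<circ> q)"
    using list_sign_permute_list[OF \<open>distinct xs\<close> permutes_compose[OF q' p(1)]] by simp
  also have "\<dots> = sign p * sign q"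
    using p(1) q' by (meson sign_compose permutes_imp_permutation finite_lessThan)
  also have "\<dots> = list_sign xs ys * list_sign ys zs"
    using list_sign_permute_list[OF \<open>distinct xs\<close> p(1)] list_sign_permute_list[OF \<open>distinct ys\<close> q(1)]
      p(2) q(2) by simp
  finally show ?thesis .
qed

lemma list_sign_mult_self [simp]: "list_sign xs ys * list_sign xs ys = 1"
  by (simp add: list_sign_def)

lemma list_sign_commute:
  assumes "distinct xs" "distinct ys" "set xs = set ys"
  shows "list_sign ys xs = list_sign xs ys"
proof -
  have "list_sign xs ys * list_sign ys xs = 1"
    using list_sign_trans[of xs ys xs] assms list_sign_self by metis
  then show ?thesis
    by (auto simp: zmult_eq_1_iff)
qed

text \<open>
Prepending a vertex shifts the permutation by one place. The shifted permutation fixes the index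
\<open>0\<close> and is conjugate to the original one, hence has the same sign.
\<close>

lemma list_sign_Cons:
  assumes "distinct (v # xs)" "distinct (v # ys)" "set xs = set ys"
  shows "list_sign (v # xs) (v # ys) = list_sign xs ys"
proof -
  obtain p where p: "p permutes {..<length xs}" "permute_list p xs = ys"
    using assms by (rule_tac obtain_permute_list[of xs ys]) auto
  define q where "q = map_permutation {..<length xs} Suc p"
  have q: "q permutes Suc ` {..<length xs}"
    unfolding q_def using p(1) by (intro map_permutation_permutes bij_betw_imageI) auto
  have q': "q permutes {..<length (v # xs)}"
    by (rule permutes_subset[OF q]) auto
  have "sign q = sign p"
    unfolding q_def using p(1) by (intro sign_map_permutation) auto
  moreover have "permute_list q (v # xs) = v # ys"
  proof (rule nth_equalityI)
    show "length (permute_list q (v # xs)) = length (v # ys)"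
      using p(2) by auto
    fix i assume "i < length (permute_list q (v # xs))"
    then have i: "i < length (v # xs)" by simp
    show "permute_list q (v # xs) ! i = (v # ys) ! i"
    proof (cases i)
      case 0
      have "q 0 = 0" by (rule permutes_not_in[OF q]) auto
      then show ?thesis using i 0 permute_list_nth[OF q' i] by simp
    next
      case (Suc j)
      have "q i = Suc (p j)"
        unfolding q_def Suc using i Suc by (intro map_permutation_apply) auto
      then show ?thesis
        using permute_list_nth[OF q' i] permute_list_nth[OF p(1), of j] p(2) i Suc by simp
    qed
  qed
  ultimately show ?thesis
    using list_sign_permute_list[OF assms(1) q'] list_sign_permute_list[OF _ p(1)] p(2) assms(1)
    by simp
qed

lemma list_sign_swap_first_two:
  assumes "distinct (a # b # xs)"
  shows "list_sign (a # b # xs) (b # a # xs) = -1"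
proof -
  have p: "Transposition.transpose 0 1 permutes {..<length (a # b # xs)}"
    by (intro permutes_swap_id) auto
  have "permute_list (Transposition.transpose 0 1) (a # b # xs) = b # a # xs"
  proof (rule nth_equalityI)
    fix i assume "i < length (permute_list (Transposition.transpose 0 1) (a # b # xs))"
    then have i: "i < length (a # b # xs)" by simp
    consider "i = 0" | "i = 1" | j where "i = Suc (Suc j)"
      by (metis One_nat_def not0_implies_Suc)
    then show "permute_list (Transposition.transpose 0 1) (a # b # xs) ! i = (b # a # xs) ! i"
      unfolding permute_list_nth[OF p i] by cases (simp_all add: Transposition.transpose_def)
  qed simp
  then show ?thesis
    using list_sign_permute_list[OF assms p] by (simp add: sign_swap_id)
qed

text \<open>
This identifies the signs \<open>(-1)\<^sup>j\<close> in the coboundary as signs of reorderings.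
\<close>

lemma list_sign_move_to_front:
  assumes "distinct (as @ v # bs)"
  shows "list_sign (as @ v # bs) (v # as @ bs) = (-1) ^ length as"
  using assms
proof (induction as)
  case Nil
  then show ?case using list_sign_self[of "v # bs"] by simp
next
  case (Cons a as)
  have "list_sign (a # as @ v # bs) (v # a # as @ bs) =
      list_sign (a # as @ v # bs) (a # v # as @ bs) * list_sign (a # v # as @ bs) (v # a # as @ bs)"
    using Cons.prems by (intro list_sign_trans) auto
  also have "\<dots> = list_sign (as @ v # bs) (v # as @ bs) * (-1)"
    using Cons.prems by (subst list_sign_Cons, auto)(subst list_sign_swap_first_two, auto)
  finally show ?case using Cons by simp
qed

section \<open>Cochains as alternating functions\<close>

lemma cochains_outside: "\<phi> \<in> cochains Y k \<Longrightarrow> xs \<notin> ordered_simplices Y k \<Longrightarrow> \<phi> xs = 0"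
  unfolding cochains_def by blast

lemma cochains_reorder:
  assumes \<phi>: "\<phi> \<in> cochains Y k" and "distinct xs" "distinct ys" "set xs = set ys"
  shows "\<phi> ys = of_int (list_sign xs ys) * \<phi> xs"
proof (cases "xs \<in> ordered_simplices Y k")
  case True
  obtain p where p: "p permutes {..<length xs}" "permute_list p xs = ys"
    using assms obtain_permute_list by metis
  have "\<phi> (permute_list p xs) = of_int (sign p) * \<phi> xs"
    using \<phi> True p(1) unfolding cochains_def by blast
  then show ?thesis
    using list_sign_permute_list[OF \<open>distinct xs\<close> p(1)] p(2) by simp
next
  case False
  then have "ys \<notin> ordered_simplices Y k" using assms by (simp add: ordered_simplices_def)
  then show ?thesis using False cochains_outside[OF \<phi>] by simp
qed

lemma cochainsI:
  assumes outside: "\<And>xs. xs \<notin> ordered_simplices Y k \<Longrightarrow> \<phi> xs = 0"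
    and reorder: "\<And>xs ys. xs \<in> ordered_simplices Y k \<Longrightarrow> distinct xs \<Longrightarrow> distinct ys \<Longrightarrow> set ys = set xs \<Longrightarrow>
           \<phi> ys = of_int (list_sign xs ys) * \<phi> xs"
  shows "\<phi> \<in> cochains Y k"
proof -
  have "\<phi> (permute_list p xs) = of_int (sign p) * \<phi> xs"
    if xs: "xs \<in> ordered_simplices Y k" and p: "p permutes {..<length xs}" for xs p
  proof -
    have d: "distinct xs" using xs by (simp add: ordered_simplices_def)
    show ?thesis
      using reorder[OF xs d, of "permute_list p xs"] list_sign_permute_list[OF d p] p d by simp
  qed
  then show ?thesis using outside unfolding cochains_def by blast
qed

lemma cochains_linear:
  fixes \<phi> \<psi> :: "'a list \<Rightarrow> real"
  assumes "\<phi> \<in> cochains Y k" "\<psi> \<in> cochains Y k"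
  shows "(\<lambda>xs. a * \<phi> xs + b * \<psi> xs) \<in> cochains Y k"
proof (rule cochainsI)
  fix xs ys :: "'a list" assume "distinct xs" "distinct ys" "set ys = set xs"
  then show "a * \<phi> ys + b * \<psi> ys = of_int (list_sign xs ys) * (a * \<phi> xs + b * \<psi> xs)"
    using cochains_reorder[OF assms(1), of xs ys] cochains_reorder[OF assms(2), of xs ys]
    by (simp add: algebra_simps)
qed (simp add: assms[THEN cochains_outside])

text \<open>
Both factors pick up the same sign, so the product depends only on the vertex \<open>v\<close> and on the
unordered face; it may be evaluated at the chosen orientation.
\<close>

lemma cochains_mult_invariant:
  assumes "\<phi> \<in> cochains Y k" "\<psi> \<in> cochains Z l" "distinct (v # xs)" "distinct (v # ys)" "set xs = set ys"
  shows "\<phi> ys * \<psi> (v # ys) = \<phi> xs * \<psi> (v # xs)"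
proof -
  have "\<phi> ys = of_int (list_sign xs ys) * \<phi> xs"
    using assms by (intro cochains_reorder[OF assms(1)]) auto
  moreover have "\<psi> (v # ys) = of_int (list_sign xs ys) * \<psi> (v # xs)"
    using cochains_reorder[OF assms(2-4)] list_sign_Cons[OF assms(3-5)] assms(5) by simp
  moreover have "of_int (list_sign xs ys) * of_int (list_sign xs ys) = (1 :: real)"
    by (metis list_sign_mult_self of_int_1 of_int_mult)
  ultimately show ?thesis by simp
qed

section \<open>Simplices and their facets\<close>

lemma finite_simplices: "simplicial_complex Y \<Longrightarrow> finite (simplices Y k)"
  by (simp add: simplices_def simplicial_complex_def)

lemma finite_of_mem_complex: "simplicial_complex Y \<Longrightarrow> \<sigma> \<in> Y \<Longrightarrow> finite \<sigma>"
  unfolding simplicial_complex_def by blast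

lemma face_mem_complex: "simplicial_complex Y \<Longrightarrow> \<tau> \<in> Y \<Longrightarrow> \<sigma> \<subseteq> \<tau> \<Longrightarrow> \<sigma> \<in> insert {} Y"
  unfolding simplicial_complex_def by blast

lemma finite_vertices: "simplicial_complex Y \<Longrightarrow> finite (\<Union>Y)"
  by (rule finite_Union) (simp_all add: finite_of_mem_complex, simp add: simplicial_complex_def)

lemma finite_simplex: "simplicial_complex Y \<Longrightarrow> \<sigma> \<in> simplices Y k \<Longrightarrow> finite \<sigma>"
  using finite_of_mem_complex by (auto simp: simplices_def)

lemma facet_of_simplex:
  assumes "simplicial_complex Y" "v \<notin> \<sigma>" "insert v \<sigma> \<in> simplices Y (k + 1)"
  shows "\<sigma> \<in> simplices Y k" "v \<in> \<Union>Y"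
proof -
  have *: "insert v \<sigma> \<in> Y" using assms(3) by (auto simp: simplices_def)
  have "finite \<sigma>" using finite_of_mem_complex[OF assms(1) *] by simp
  moreover have "\<sigma> \<in> insert {} Y"
    using face_mem_complex[OF assms(1) *] by blast
  ultimately show "\<sigma> \<in> simplices Y k"
    using assms(2,3) by (simp add: simplices_def)
  show "v \<in> \<Union>Y" using * by auto
qed

lemma facet_simplex:
  assumes "simplicial_complex Y" "\<tau> \<in> simplices Y (k + 1)" "v \<in> \<tau>"
  shows "\<tau> - {v} \<in> simplices Y k"
  using facet_of_simplex(1)[OF assms(1), of v "\<tau> - {v}"] assms(2,3) by (simp add: insert_absorb)

lemma orientation_simplex:
  assumes "orientation Y ori" "\<sigma> \<in> simplices Y k"
  shows "distinct (ori \<sigma>)" "set (ori \<sigma>) = \<sigma>" "ori \<sigma> \<in> ordered_simplices Y k"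
  using assms by (auto simp: orientation_def simplices_def ordered_simplices_def)

section \<open>The coboundary operator and its adjoint\<close>

text \<open>
Indexing the sum by vertices instead of positions makes it visible how the coboundary behaves when
the simplex is reordered.
\<close>

lemma coboundary_eq_sum_vertices:
  assumes "xs \<in> ordered_simplices Y (k + 1)"
  shows "coboundary Y k \<phi> xs =
    (\<Sum>v\<in>set xs. of_int (list_sign xs (v # remove1 v xs)) * \<phi> (remove1 v xs))"
proof -
  have d: "distinct xs" using assms by (simp add: ordered_simplices_def)
  have "(\<Sum>v\<in>set xs. of_int (list_sign xs (v # remove1 v xs)) * \<phi> (remove1 v xs)) =
    (\<Sum>j<length xs. of_int (list_sign xs (xs ! j # remove1 (xs ! j) xs)) * \<phi> (remove1 (xs ! j) xs))"
    by (rule sum.reindex_bij_betw[symmetric], rule bij_betw_nth) (use d in auto)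
  also have "\<dots> = (\<Sum>j<length xs. (-1) ^ j * \<phi> (take j xs @ drop (Suc j) xs))"
  proof (rule sum.cong)
    fix j assume j: "j \<in> {..<length xs}"
    then have xs: "xs = take j xs @ xs ! j # drop (Suc j) xs"
      by (simp add: id_take_nth_drop)
    then have d': "distinct (take j xs @ xs ! j # drop (Suc j) xs)"
      using d by metis
    then have "remove1 (xs ! j) (take j xs @ xs ! j # drop (Suc j) xs) = take j xs @ drop (Suc j) xs"
      by (simp add: remove1_append)
    then have r: "remove1 (xs ! j) xs = take j xs @ drop (Suc j) xs"
      using xs by metis
    have "list_sign xs (xs ! j # take j xs @ drop (Suc j) xs) = (-1) ^ length (take j xs)"
      using list_sign_move_to_front[OF d'] xs by metis
    then show "of_int (list_sign xs (xs ! j # remove1 (xs ! j) xs)) * \<phi> (remove1 (xs ! j) xs) =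
        (-1) ^ j * \<phi> (take j xs @ drop (Suc j) xs)"
      using j by (simp add: r)
  qed simp
  finally show ?thesis using assms by (simp add: coboundary_def)
qed

text \<open>
Going from \<open>xs\<close> to \<open>ys\<close>, the sign of the term of \<open>v\<close> changes by the product of \<open>list_sign xs ys\<close> and
the sign relating the two orderings of the facet opposite \<open>v\<close>; the latter is cancelled by the
alternation of \<open>\<phi>\<close> on that facet.
\<close>

lemma coboundary_cochain:
  assumes "\<phi> \<in> cochains Y k"
  shows "coboundary Y k \<phi> \<in> cochains Y (k + 1)"
proof (rule cochainsI)
  fix xs ys assume xs: "xs \<in> ordered_simplices Y (k + 1)" "distinct xs" and ys: "distinct ys" "set ys = set xs"
  have ys': "ys \<in> ordered_simplices Y (k + 1)"
    using xs ys by (simp add: ordered_simplices_def)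
  have "of_int (list_sign ys (v # remove1 v ys)) * \<phi> (remove1 v ys) =
      of_int (list_sign xs ys) * (of_int (list_sign xs (v # remove1 v xs)) * \<phi> (remove1 v xs))"
    if v: "v \<in> set xs" for v
  proof -
    let ?x = "remove1 v xs" and ?y = "remove1 v ys"
    have d: "distinct (v # ?x)" "distinct (v # ?y)" "set ?x = set ?y" "set (v # ?x) = set xs"
      "set (v # ?y) = set xs"
      using xs ys v by (auto simp: distinct_remove1)
    have "list_sign ys (v # ?y) = list_sign ys xs * list_sign xs (v # ?y)"
      using d xs ys by (intro list_sign_trans) auto
    also have "list_sign xs (v # ?y) = list_sign xs (v # ?x) * list_sign (v # ?x) (v # ?y)"
      using d xs ys by (intro list_sign_trans) auto
    also have "list_sign (v # ?x) (v # ?y) = list_sign ?x ?y"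
      using d by (intro list_sign_Cons) auto
    also have "list_sign ys xs = list_sign xs ys"
      using xs ys by (intro list_sign_commute) auto
    finally have s: "list_sign ys (v # ?y) = list_sign xs ys * (list_sign xs (v # ?x) * list_sign ?x ?y)" .
    have "\<phi> ?y = of_int (list_sign ?x ?y) * \<phi> ?x"
      using d by (intro cochains_reorder[OF assms]) auto
    moreover have "of_int (list_sign ?x ?y) * of_int (list_sign ?x ?y) = (1 :: real)"
      by (metis list_sign_mult_self of_int_1 of_int_mult)
    ultimately show ?thesis
      by (simp add: s)
  qed
  then show "coboundary Y k \<phi> ys = of_int (list_sign xs ys) * coboundary Y k \<phi> xs"
    using ys by (simp add: coboundary_eq_sum_vertices[OF xs(1)] coboundary_eq_sum_vertices[OF ys'] sum_distrib_left)
qed (simp add: coboundary_def)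

text \<open>
The explicit formula for the adjoint of the coboundary: sum over all cofaces, each ordered with the
new vertex first. The sum may run over all vertices because a cochain \<open>\<psi>\<close> vanishes on lists
that are not ordered simplices.
\<close>

definition coboundary_transpose :: "'a set set \<Rightarrow> int \<Rightarrow> ('a list \<Rightarrow> real) \<Rightarrow> 'a list \<Rightarrow> real" where
  "coboundary_transpose Y k \<psi> xs =
     (if xs \<in> ordered_simplices Y k then \<Sum>v\<in>\<Union>Y. \<psi> (v # xs) else 0)"

lemma coboundary_transpose_cochain:
  assumes "\<psi> \<in> cochains Y (k + 1)"
  shows "coboundary_transpose Y k \<psi> \<in> cochains Y k"
proof (rule cochainsI)
  fix xs ys assume xs: "xs \<in> ordered_simplices Y k" "distinct xs" and ys: "distinct ys" "set ys = set xs"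
  have ys': "ys \<in> ordered_simplices Y k"
    using xs ys by (simp add: ordered_simplices_def)
  have "\<psi> (v # ys) = of_int (list_sign xs ys) * \<psi> (v # xs)" for v
  proof (cases "v \<in> set xs")
    case True
    then show ?thesis
      using ys cochains_outside[OF assms] by (simp add: ordered_simplices_def)
  next
    case False
    then have "list_sign (v # xs) (v # ys) = list_sign xs ys"
      using xs ys by (intro list_sign_Cons) auto
    moreover have "\<psi> (v # ys) = of_int (list_sign (v # xs) (v # ys)) * \<psi> (v # xs)"
      using False xs ys by (intro cochains_reorder[OF assms]) auto
    ultimately show ?thesis by simp
  qed
  then show "coboundary_transpose Y k \<psi> ys = of_int (list_sign xs ys) * coboundary_transpose Y k \<psi> xs"
    using xs ys' by (simp add: coboundary_transpose_def sum_distrib_left)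
qed (simp add: coboundary_transpose_def)

text \<open>
Both sides equal the sum, over all incident pairs of a face and a coface, of
\<open>\<phi>(\<sigma>) \<psi>(v\<sigma>)\<close>, where \<open>v\<close> is the vertex of the coface outside the face \<open>\<sigma>\<close>. On the left a pair is
indexed by the coface and \<open>v\<close>, on the right by the face and \<open>v\<close>.
\<close>

lemma cochain_inner_coboundary:
  assumes Y: "simplicial_complex Y" and ori: "orientation Y ori"
    and \<phi>: "\<phi> \<in> cochains Y k" and \<psi>: "\<psi> \<in> cochains Y (k + 1)"
  shows "cochain_inner ori Y (k + 1) (coboundary Y k \<phi>) \<psi> =
    cochain_inner ori Y k \<phi> (coboundary_transpose Y k \<psi>)"
proof -
  note o = orientation_simplex[OF ori]
  let ?g = "\<lambda>\<sigma> v. \<phi> (ori \<sigma>) * \<psi> (v # ori \<sigma>)"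
  have "coboundary Y k \<phi> (ori \<tau>) * \<psi> (ori \<tau>) = (\<Sum>v\<in>\<tau>. ?g (\<tau> - {v}) v)"
    if \<tau>: "\<tau> \<in> simplices Y (k + 1)" for \<tau>
  proof -
    let ?t = "ori \<tau>"
    have "coboundary Y k \<phi> ?t * \<psi> ?t =
        (\<Sum>v\<in>\<tau>. \<phi> (remove1 v ?t) * (of_int (list_sign ?t (v # remove1 v ?t)) * \<psi> ?t))"
      using o(2,3)[OF \<tau>] by (simp add: coboundary_eq_sum_vertices sum_distrib_left mult_ac)
    also have "\<dots> = (\<Sum>v\<in>\<tau>. ?g (\<tau> - {v}) v)"
    proof (rule sum.cong)
      fix v assume v: "v \<in> \<tau>"
      have d: "distinct (v # remove1 v ?t)" "set (remove1 v ?t) = \<tau> - {v}"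
        using o(1,2)[OF \<tau>] v by (auto simp: distinct_remove1)
      have "of_int (list_sign ?t (v # remove1 v ?t)) * \<psi> ?t = \<psi> (v # remove1 v ?t)"
        using d o(1,2)[OF \<tau>] v by (intro cochains_reorder[OF \<psi>, symmetric]) auto
      moreover have "\<phi> (remove1 v ?t) * \<psi> (v # remove1 v ?t) = ?g (\<tau> - {v}) v"
        using d o(1,2)[OF facet_simplex[OF Y \<tau> v]]
        by (intro cochains_mult_invariant[OF \<phi> \<psi>]) auto
      ultimately show "\<phi> (remove1 v ?t) * (of_int (list_sign ?t (v # remove1 v ?t)) * \<psi> ?t) = ?g (\<tau> - {v}) v"
        by simp
    qed simp
    finally show ?thesis .
  qed
  then have "cochain_inner ori Y (k + 1) (coboundary Y k \<phi>) \<psi> =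
      (\<Sum>\<tau>\<in>simplices Y (k + 1). \<Sum>v\<in>\<tau>. ?g (\<tau> - {v}) v)"
    by (simp add: cochain_inner_def)
  also have "\<dots> = (\<Sum>(\<tau>, v)\<in>Sigma (simplices Y (k + 1)) (\<lambda>\<tau>. \<tau>). ?g (\<tau> - {v}) v)"
    using finite_simplices[OF Y] finite_simplex[OF Y] by (intro sum.Sigma) auto
  also have "\<dots> = (\<Sum>(\<sigma>, v)\<in>simplices Y k \<times> \<Union>Y. ?g \<sigma> v)"
  proof (rule sum.reindex_bij_witness_not_neutral[where S' = "{}"
        and T' = "{(\<sigma>, v) \<in> simplices Y k \<times> \<Union>Y. v \<in> \<sigma> \<or> insert v \<sigma> \<notin> simplices Y (k + 1)}"
        and i = "\<lambda>(\<sigma>, v). (insert v \<sigma>, v)" and j = "\<lambda>(\<tau>, v). (\<tau> - {v}, v)"])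
    have "finite (simplices Y k \<times> \<Union>Y)"
      using finite_simplices[OF Y] finite_vertices[OF Y] by (rule finite_cartesian_product)
    then show "finite {(\<sigma>, v) \<in> simplices Y k \<times> \<Union>Y. v \<in> \<sigma> \<or> insert v \<sigma> \<notin> simplices Y (k + 1)}"
      by (rule rev_finite_subset) auto
    show "(\<lambda>(\<tau>, v). (\<tau> - {v}, v)) a \<in> simplices Y k \<times> \<Union>Y -
        {(\<sigma>, v) \<in> simplices Y k \<times> \<Union>Y. v \<in> \<sigma> \<or> insert v \<sigma> \<notin> simplices Y (k + 1)}"
      if "a \<in> Sigma (simplices Y (k + 1)) (\<lambda>\<tau>. \<tau>) - {}" for a
      using that facet_simplex[OF Y] by (auto simp: insert_absorb simplices_def)
    show "(\<lambda>(\<sigma>, v). ?g \<sigma> v) b = 0"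
      if b: "b \<in> {(\<sigma>, v) \<in> simplices Y k \<times> \<Union>Y. v \<in> \<sigma> \<or> insert v \<sigma> \<notin> simplices Y (k + 1)}" for b
    proof -
      obtain \<sigma> v where b': "b = (\<sigma>, v)" by (cases b)
      then have "v # ori \<sigma> \<notin> ordered_simplices Y (k + 1)"
        using b o(1,2)[of \<sigma> k] by (auto simp: ordered_simplices_def)
      then show ?thesis using cochains_outside[OF \<psi>] b' by simp
    qed
  qed auto
  also have "\<dots> = (\<Sum>\<sigma>\<in>simplices Y k. \<Sum>v\<in>\<Union>Y. ?g \<sigma> v)"
    by (rule sum.cartesian_product[symmetric])
  also have "\<dots> = cochain_inner ori Y k \<phi> (coboundary_transpose Y k \<psi>)"
    unfolding cochain_inner_def
    by (rule sum.cong) (use o(3) in \<open>auto simp: coboundary_transpose_def sum_distrib_left\<close>)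
  finally show ?thesis .
qed

lemma cochain_inner_commute: "cochain_inner ori Y k \<phi> \<psi> = cochain_inner ori Y k \<psi> \<phi>"
  by (simp add: cochain_inner_def mult.commute)

lemma cochain_inner_linear:
  "cochain_inner ori Y k (\<lambda>xs. a * \<phi> xs + b * \<chi> xs) \<psi> =
    a * cochain_inner ori Y k \<phi> \<psi> + b * cochain_inner ori Y k \<chi> \<psi>"
  by (simp add: cochain_inner_def sum_distrib_left sum.distrib algebra_simps)

text \<open>
A cochain is determined by its values at the chosen orientations.
\<close>

lemma cochain_inner_self_eq_0:
  assumes Y: "simplicial_complex Y" and ori: "orientation Y ori" and \<phi>: "\<phi> \<in> cochains Y k"
    and 0: "cochain_inner ori Y k \<phi> \<phi> = 0"
  shows "\<phi> = (\<lambda>_. 0)"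
proof
  fix xs
  have z: "\<phi> (ori \<sigma>) = 0" if "\<sigma> \<in> simplices Y k" for \<sigma>
    using 0 that finite_simplices[OF Y] by (simp add: cochain_inner_def sum_nonneg_eq_0_iff)
  show "\<phi> xs = 0"
  proof (cases "xs \<in> ordered_simplices Y k")
    case True
    then have s: "set xs \<in> simplices Y k" "distinct xs" by (auto simp: ordered_simplices_def)
    then show ?thesis
      using cochains_reorder[OF \<phi>, of "ori (set xs)" xs] orientation_simplex[OF ori s(1)] z[OF s(1)]
      by simp
  qed (use cochains_outside[OF \<phi>] in simp)
qed

lemma cochains_eqI:
  assumes Y: "simplicial_complex Y" and ori: "orientation Y ori"
    and \<chi>: "\<chi> \<in> cochains Y k" "\<chi>' \<in> cochains Y k"
    and eq: "\<And>\<phi>. \<phi> \<in> cochains Y k \<Longrightarrow> cochain_inner ori Y k \<chi> \<phi> = cochain_inner ori Y k \<chi>' \<phi>"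
  shows "\<chi> = \<chi>'"
proof -
  let ?d = "\<lambda>xs. 1 * \<chi> xs + (-1) * \<chi>' xs"
  have d: "?d \<in> cochains Y k" by (rule cochains_linear[OF \<chi>])
  have "cochain_inner ori Y k ?d ?d = 0"
    unfolding cochain_inner_linear[of ori Y k 1 \<chi> "-1"] using eq[OF d] by simp
  then have "?d = (\<lambda>_. 0)" by (rule cochain_inner_self_eq_0[OF Y ori d])
  then show ?thesis by (simp add: fun_eq_iff)
qed

text \<open>
Existence of the adjoint is the preceding computation; uniqueness holds because the inner product
is nondegenerate on cochains.
\<close>

lemma coboundary_adjoint_eq:
  assumes Y: "simplicial_complex Y" and ori: "orientation Y ori" and \<psi>: "\<psi> \<in> cochains Y (k + 1)"
  shows "coboundary_adjoint ori Y k \<psi> = coboundary_transpose Y k \<psi>"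
  unfolding coboundary_adjoint_def
proof (rule the_equality)
  show "coboundary_transpose Y k \<psi> \<in> cochains Y k \<and> (\<forall>\<phi>\<in>cochains Y k.
      cochain_inner ori Y (k + 1) (coboundary Y k \<phi>) \<psi> =
      cochain_inner ori Y k \<phi> (coboundary_transpose Y k \<psi>))"
    using coboundary_transpose_cochain[OF \<psi>] cochain_inner_coboundary[OF Y ori _ \<psi>] by blast
next
  fix \<chi>
  assume \<chi>: "\<chi> \<in> cochains Y k \<and> (\<forall>\<phi>\<in>cochains Y k.
      cochain_inner ori Y (k + 1) (coboundary Y k \<phi>) \<psi> = cochain_inner ori Y k \<phi> \<chi>)"
  show "\<chi> = coboundary_transpose Y k \<psi>"
  proof (rule cochains_eqI[OF Y ori])
    show "cochain_inner ori Y k \<chi> \<phi> = cochain_inner ori Y k (coboundary_transpose Y k \<psi>) \<phi>"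
      if "\<phi> \<in> cochains Y k" for \<phi>
      using \<chi> that cochain_inner_coboundary[OF Y ori that \<psi>] by (metis cochain_inner_commute)
  qed (use \<chi> coboundary_transpose_cochain[OF \<psi>] in auto)
qed

section \<open>The quadratic form of the Laplacian\<close>

text \<open>
On cochains this is \<open>\<langle>\<Delta>\<phi>, \<psi>\<rangle>\<close> in its manifestly symmetric form \<open>\<langle>\<delta>\<^sup>*\<phi>, \<delta>\<^sup>*\<psi>\<rangle> + \<langle>\<delta>\<phi>, \<delta>\<psi>\<rangle>\<close>. It is a finite expression
in the values of \<open>\<phi>\<close> and \<open>\<psi>\<close>, so it makes sense for, and is continuous in, arbitrary functions.
\<close>

definition dirichlet_form ::
  "('a set \<Rightarrow> 'a list) \<Rightarrow> 'a set set \<Rightarrow> int \<Rightarrow> ('a list \<Rightarrow> real) \<Rightarrow> ('a list \<Rightarrow> real) \<Rightarrow> real" where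
  "dirichlet_form ori Y k \<phi> \<psi> =
     cochain_inner ori Y (k - 1) (coboundary_transpose Y (k - 1) \<phi>) (coboundary_transpose Y (k - 1) \<psi>) +
     cochain_inner ori Y (k + 1) (coboundary Y k \<phi>) (coboundary Y k \<psi>)"

lemma laplacian_eq:
  assumes Y: "simplicial_complex Y" and ori: "orientation Y ori" and \<phi>: "\<phi> \<in> cochains Y k"
  shows "laplacian ori Y k \<phi> = (\<lambda>xs. 1 * coboundary Y (k - 1) (coboundary_transpose Y (k - 1) \<phi>) xs +
           1 * coboundary_transpose Y k (coboundary Y k \<phi>) xs)"
  using coboundary_adjoint_eq[OF Y ori, of \<phi> "k - 1"] coboundary_adjoint_eq[OF Y ori coboundary_cochain[OF \<phi>]] \<phi>
  by (simp add: laplacian_def)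

lemma laplacian_cochain:
  assumes Y: "simplicial_complex Y" and ori: "orientation Y ori" and \<phi>: "\<phi> \<in> cochains Y k"
  shows "laplacian ori Y k \<phi> \<in> cochains Y k"
proof -
  have "coboundary_transpose Y (k - 1) \<phi> \<in> cochains Y (k - 1)"
    using coboundary_transpose_cochain[of \<phi> Y "k - 1"] \<phi> by simp
  then have "coboundary Y (k - 1) (coboundary_transpose Y (k - 1) \<phi>) \<in> cochains Y k"
    using coboundary_cochain[of _ Y "k - 1"] by simp
  then show ?thesis
    unfolding laplacian_eq[OF assms]
    by (rule cochains_linear[OF _ coboundary_transpose_cochain[OF coboundary_cochain[OF \<phi>]]])
qed

lemma cochain_inner_laplacian:
  assumes Y: "simplicial_complex Y" and ori: "orientation Y ori"
    and \<phi>: "\<phi> \<in> cochains Y k" and \<psi>: "\<psi> \<in> cochains Y k"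
  shows "cochain_inner ori Y k (laplacian ori Y k \<phi>) \<psi> = dirichlet_form ori Y k \<phi> \<psi>"
proof -
  have "coboundary_transpose Y (k - 1) \<phi> \<in> cochains Y (k - 1)"
    using coboundary_transpose_cochain[of \<phi> Y "k - 1"] \<phi> by simp
  then have "cochain_inner ori Y k (coboundary Y (k - 1) (coboundary_transpose Y (k - 1) \<phi>)) \<psi> =
      cochain_inner ori Y (k - 1) (coboundary_transpose Y (k - 1) \<phi>) (coboundary_transpose Y (k - 1) \<psi>)"
    using cochain_inner_coboundary[OF Y ori, of _ "k - 1" \<psi>] \<psi> by simp
  moreover have "cochain_inner ori Y k (coboundary_transpose Y k (coboundary Y k \<phi>)) \<psi> =
      cochain_inner ori Y (k + 1) (coboundary Y k \<phi>) (coboundary Y k \<psi>)"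
    using cochain_inner_coboundary[OF Y ori \<psi> coboundary_cochain[OF \<phi>]]
    by (simp only: cochain_inner_commute[of ori Y k \<psi>] cochain_inner_commute[of ori Y "k + 1" "coboundary Y k \<psi>"])
  ultimately show ?thesis
    unfolding laplacian_eq[OF Y ori \<phi>] cochain_inner_linear dirichlet_form_def by simp
qed

lemma coboundary_linear:
  "coboundary Y k (\<lambda>xs. a * \<phi> xs + b * \<psi> xs) =
    (\<lambda>xs. a * coboundary Y k \<phi> xs + b * coboundary Y k \<psi> xs)"
  by (rule ext) (simp add: coboundary_def sum_distrib_left sum.distrib algebra_simps)

lemma coboundary_transpose_linear:
  "coboundary_transpose Y k (\<lambda>xs. a * \<phi> xs + b * \<psi> xs) =
    (\<lambda>xs. a * coboundary_transpose Y k \<phi> xs + b * coboundary_transpose Y k \<psi> xs)"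
  by (rule ext) (simp add: coboundary_transpose_def sum_distrib_left sum.distrib)

lemma dirichlet_form_linear:
  "dirichlet_form ori Y k (\<lambda>xs. a * \<phi> xs + b * \<chi> xs) \<psi> =
    a * dirichlet_form ori Y k \<phi> \<psi> + b * dirichlet_form ori Y k \<chi> \<psi>"
  by (simp add: dirichlet_form_def coboundary_linear coboundary_transpose_linear cochain_inner_linear
      algebra_simps)

lemma cochain_inner_square:
  "cochain_inner ori Y k (\<lambda>xs. a * \<phi> xs + b * \<psi> xs) (\<lambda>xs. a * \<phi> xs + b * \<psi> xs) =
    a\<^sup>2 * cochain_inner ori Y k \<phi> \<phi> + 2 * a * b * cochain_inner ori Y k \<phi> \<psi> + b\<^sup>2 * cochain_inner ori Y k \<psi> \<psi>"
  by (simp add: cochain_inner_def sum_distrib_left sum.distrib[symmetric] algebra_simps power2_eq_square)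

lemma dirichlet_form_square:
  "dirichlet_form ori Y k (\<lambda>xs. a * \<phi> xs + b * \<psi> xs) (\<lambda>xs. a * \<phi> xs + b * \<psi> xs) =
    a\<^sup>2 * dirichlet_form ori Y k \<phi> \<phi> + 2 * a * b * dirichlet_form ori Y k \<phi> \<psi> + b\<^sup>2 * dirichlet_form ori Y k \<psi> \<psi>"
  by (simp add: dirichlet_form_def coboundary_linear coboundary_transpose_linear cochain_inner_square
      algebra_simps)

section \<open>The minimal eigenvalue as the minimum of the Rayleigh quotient\<close>

lemma continuous_cochain_inner_coordinates:
  assumes "\<And>xs. continuous_on UNIV (\<lambda>\<phi>. f \<phi> xs)"
  shows "continuous_on UNIV (\<lambda>\<phi>. cochain_inner ori Y k (f \<phi>) (f \<phi>))"
  unfolding cochain_inner_def by (intro continuous_intros assms)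

lemma continuous_cochain_inner: "continuous_on UNIV (\<lambda>\<phi>. cochain_inner ori Y k \<phi> \<phi>)"
  by (rule continuous_cochain_inner_coordinates) simp

lemma continuous_dirichlet_form: "continuous_on UNIV (\<lambda>\<phi>. dirichlet_form ori Y k \<phi> \<phi>)"
proof -
  have "continuous_on UNIV (\<lambda>\<phi>. coboundary Y k \<phi> xs)" for xs
    unfolding coboundary_def
    by (cases "xs \<in> ordered_simplices Y (k + 1)") (auto intro!: continuous_intros)
  moreover have "continuous_on UNIV (\<lambda>\<phi>. coboundary_transpose Y (k - 1) \<phi> xs)" for xs
    unfolding coboundary_transpose_def
    by (cases "xs \<in> ordered_simplices Y (k - 1)") (auto intro!: continuous_intros)
  ultimately show ?thesis
    unfolding dirichlet_form_def by (intro continuous_on_add continuous_cochain_inner_coordinates)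
qed

lemma closed_cochains: "closed (cochains Y k)"
proof -
  have "cochains Y k = (\<Inter>xs\<in>- ordered_simplices Y k. {\<phi>. \<phi> xs = 0}) \<inter>
      (\<Inter>xs\<in>ordered_simplices Y k. \<Inter>p\<in>{p. p permutes {..<length xs}}.
        {\<phi>. \<phi> (permute_list p xs) = of_int (sign p) * \<phi> xs})"
    unfolding cochains_def by blast
  also have "closed \<dots>"
    by (intro closed_Int closed_INT ballI closed_Collect_eq continuous_intros continuous_on_product_coordinates)
  finally show ?thesis .
qed

text \<open>
On the unit sphere all values lie in \<open>[-1, 1]\<close>, so the sphere is a closed subset of a cube, which is
compact by Tychonoff's theorem. Working in the product topology on all functions avoids the choice
of coordinates on the space of cochains.
\<close>

lemma compact_unit_cochains:
  assumes Y: "simplicial_complex Y" and ori: "orientation Y ori"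
  shows "compact {\<phi> \<in> cochains Y k. cochain_inner ori Y k \<phi> \<phi> = 1}"
proof -
  let ?B = "PiE UNIV (\<lambda>_. {-1..1}) :: ('a list \<Rightarrow> real) set"
  have "compactin (product_topology (\<lambda>_. euclidean) UNIV) ?B"
    unfolding compactin_PiE by simp
  then have B: "compact ?B"
    by (simp add: euclidean_product_topology)
  have "\<phi> \<in> ?B" if \<phi>: "\<phi> \<in> cochains Y k" and 1: "cochain_inner ori Y k \<phi> \<phi> = 1" for \<phi>
  proof -
    have "\<bar>\<phi> xs\<bar> \<le> 1" for xs
    proof (cases "xs \<in> ordered_simplices Y k")
      case True
      then have xs: "set xs \<in> simplices Y k" "distinct xs" by (auto simp: ordered_simplices_def)
      have "\<phi> xs = of_int (list_sign (ori (set xs)) xs) * \<phi> (ori (set xs))"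
        using orientation_simplex[OF ori xs(1)] xs(2) by (intro cochains_reorder[OF \<phi>]) auto
      then have "\<bar>\<phi> xs\<bar> = \<bar>\<phi> (ori (set xs))\<bar>"
        by (simp add: abs_mult list_sign_def sign_def)
      moreover have "(\<phi> (ori (set xs)))\<^sup>2 \<le> cochain_inner ori Y k \<phi> \<phi>"
        unfolding cochain_inner_def power2_eq_square
        by (rule member_le_sum[OF xs(1)]) (simp_all add: finite_simplices[OF Y])
      ultimately show ?thesis
        by (simp add: 1 abs_square_le_1)
    qed (simp add: cochains_outside[OF \<phi>])
    then show ?thesis by (auto simp: abs_le_iff PiE_iff minus_le_iff)
  qed
  then have "{\<phi> \<in> cochains Y k. cochain_inner ori Y k \<phi> \<phi> = 1} =
      ?B \<inter> (cochains Y k \<inter> {\<phi>. cochain_inner ori Y k \<phi> \<phi> = 1})"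
    by blast
  also have "compact \<dots>"
    by (intro compact_Int_closed B closed_Int closed_cochains closed_Collect_eq
        continuous_cochain_inner continuous_on_const)
  finally show ?thesis .
qed

text \<open>
The witness is the elementary cochain of \<open>\<sigma>\<close>: the sign of the ordering relative to the chosen
orientation on the orderings of \<open>\<sigma>\<close>, and zero elsewhere.
\<close>

lemma unit_cochain_exists:
  fixes Y :: "'a set set"
  assumes Y: "simplicial_complex Y" and ori: "orientation Y ori" and \<sigma>: "\<sigma> \<in> simplices Y k"
  shows "\<exists>\<phi>\<in>cochains Y k. cochain_inner ori Y k \<phi> \<phi> = 1"
proof
  let ?e = "\<lambda>xs. if distinct xs \<and> set xs = \<sigma> then of_int (list_sign (ori \<sigma>) xs) else 0 :: real"
  show "?e \<in> cochains Y k"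
  proof (rule cochainsI)
    fix xs assume "xs \<notin> ordered_simplices Y k"
    then show "?e xs = 0" using \<sigma> by (auto simp: ordered_simplices_def)
  next
    fix xs ys :: "'a list" assume *: "distinct xs" "distinct ys" "set ys = set xs"
    show "?e ys = of_int (list_sign xs ys) * ?e xs"
    proof (cases "set xs = \<sigma>")
      case True
      then have "list_sign (ori \<sigma>) ys = list_sign (ori \<sigma>) xs * list_sign xs ys"
        using * orientation_simplex[OF ori \<sigma>] by (intro list_sign_trans) auto
      then show ?thesis using * True by simp
    qed (use * in simp)
  qed
  have "cochain_inner ori Y k ?e ?e = (\<Sum>\<tau>\<in>simplices Y k. if \<tau> = \<sigma> then 1 else 0)"
    unfolding cochain_inner_def
    using orientation_simplex[OF ori] by (intro sum.cong) (auto simp: list_sign_self)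
  then show "cochain_inner ori Y k ?e ?e = 1"
    using \<sigma> finite_simplices[OF Y] by simp
qed

text \<open>
The first-order condition at a minimum, in the form in which the Rayleigh quotient provides it.
\<close>

lemma linear_term_eq_0:
  fixes d e :: real
  assumes "\<And>t. 0 \<le> 2 * t * d + t\<^sup>2 * e"
  shows "d = 0"
proof (rule ccontr)
  assume "d \<noteq> 0"
  \<comment> \<open>With \<open>t = - d / s\<close> and \<open>s > e / 2\<close> the negative linear term outweighs the quadratic one.\<close>
  define s where "s = \<bar>e\<bar> + 1"
  have s: "s > 0" "e - 2 * s < 0" by (auto simp: s_def)
  have "2 * (- d / s) * d + (- d / s)\<^sup>2 * e = (d\<^sup>2 / s\<^sup>2) * (e - 2 * s)"
    using s(1) by (simp add: power2_eq_square field_simps)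
  also have "\<dots> < 0"
    using s \<open>d \<noteq> 0\<close> by (intro mult_pos_neg) auto
  finally show False using assms[of "- d / s"] by simp
qed

lemma cochain_inner_nonneg: "0 \<le> cochain_inner ori Y k \<phi> \<phi>"
  by (simp add: cochain_inner_def sum_nonneg)

text \<open>
A minimiser \<open>\<phi>\<close> of the form on the compact unit sphere minimises it, with respect to the norm, on
all cochains by homogeneity. Comparing \<open>\<phi>\<close> with \<open>\<phi> + t\<psi>\<close> for all real \<open>t\<close> gives
\<open>\<langle>\<Delta>\<phi>, \<psi>\<rangle> = c\<langle>\<phi>, \<psi>\<rangle>\<close>, so the minimum \<open>c\<close> is an eigenvalue; every other eigenvalue is the Rayleigh
quotient of its eigenvector, hence at least \<open>c\<close>.
\<close>

lemma min_eigenvalue_rayleigh: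
  assumes Y: "simplicial_complex Y" and ori: "orientation Y ori" and ne: "simplices Y k \<noteq> {}"
  obtains \<phi> where "\<phi> \<in> cochains Y k" "cochain_inner ori Y k \<phi> \<phi> = 1"
    "dirichlet_form ori Y k \<phi> \<phi> = min_eigenvalue ori Y k"
    "\<And>\<psi>. \<psi> \<in> cochains Y k \<Longrightarrow>
       min_eigenvalue ori Y k * cochain_inner ori Y k \<psi> \<psi> \<le> dirichlet_form ori Y k \<psi> \<psi>"
proof -
  let ?N = "cochain_inner ori Y k" and ?D = "dirichlet_form ori Y k"
  let ?S = "{\<phi> \<in> cochains Y k. ?N \<phi> \<phi> = 1}"
  obtain \<sigma> where "\<sigma> \<in> simplices Y k" using ne by blast
  then have "?S \<noteq> {}" using unit_cochain_exists[OF Y ori] by blast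
  then obtain \<phi> where \<phi>: "\<phi> \<in> ?S" "\<And>\<psi>. \<psi> \<in> ?S \<Longrightarrow> ?D \<phi> \<phi> \<le> ?D \<psi> \<psi>"
    using continuous_attains_inf[OF compact_unit_cochains[OF Y ori] _
        continuous_on_subset[OF continuous_dirichlet_form subset_UNIV]] by blast
  define c where "c = ?D \<phi> \<phi>"
  have rayleigh: "c * ?N \<psi> \<psi> \<le> ?D \<psi> \<psi>" if \<psi>: "\<psi> \<in> cochains Y k" for \<psi>
  proof (cases "?N \<psi> \<psi> = 0")
    case True
    then have "\<psi> = (\<lambda>_. 0)" by (rule cochain_inner_self_eq_0[OF Y ori \<psi>])
    then show ?thesis
      using dirichlet_form_linear[of ori Y k 0 \<psi> 0 \<psi> \<psi>] True by simp
  next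
    case False
    then have n: "?N \<psi> \<psi> > 0" using cochain_inner_nonneg[of ori Y k \<psi>] by simp
    let ?a = "1 / sqrt (?N \<psi> \<psi>)"
    \<comment> \<open>A multiple is written as a linear combination so that the identities for linear combinations apply to it.\<close>
    let ?\<psi> = "\<lambda>xs. ?a * \<psi> xs + 0 * \<psi> xs"
    have a: "?a\<^sup>2 = 1 / ?N \<psi> \<psi>" using n by (simp add: power_divide)
    have "?N ?\<psi> ?\<psi> = 1"
      unfolding cochain_inner_square a using n by simp
    then have "c \<le> ?D ?\<psi> ?\<psi>"
      unfolding c_def using \<phi>(2)[of ?\<psi>] cochains_linear[OF \<psi> \<psi>] by blast
    also have "\<dots> = ?D \<psi> \<psi> / ?N \<psi> \<psi>"
      unfolding dirichlet_form_square a by simp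
    finally show ?thesis using n by (simp add: field_simps)
  qed
  have crit: "?D \<phi> \<psi> = c * ?N \<phi> \<psi>" if \<psi>: "\<psi> \<in> cochains Y k" for \<psi>
  proof -
    have "0 \<le> 2 * t * (?D \<phi> \<psi> - c * ?N \<phi> \<psi>) + t\<^sup>2 * (?D \<psi> \<psi> - c * ?N \<psi> \<psi>)" for t
    proof -
      have "(\<lambda>xs. 1 * \<phi> xs + t * \<psi> xs) \<in> cochains Y k"
        using \<phi>(1) \<psi> by (intro cochains_linear) auto
      from rayleigh[OF this] show ?thesis
        unfolding cochain_inner_square dirichlet_form_square
        using \<phi>(1) by (simp add: c_def algebra_simps)
    qed
    then show ?thesis using linear_term_eq_0 by fastforce
  qed
  have "laplacian ori Y k \<phi> = (\<lambda>xs. c * \<phi> xs + 0 * \<phi> xs)"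
  proof (rule cochains_eqI[OF Y ori])
    fix \<psi> assume \<psi>: "\<psi> \<in> cochains Y k"
    show "?N (laplacian ori Y k \<phi>) \<psi> = ?N (\<lambda>xs. c * \<phi> xs + 0 * \<phi> xs) \<psi>"
      using cochain_inner_laplacian[OF Y ori _ \<psi>, of \<phi>] \<phi>(1) crit[OF \<psi>] cochain_inner_linear[of ori Y k c \<phi> 0 \<phi> \<psi>]
      by simp
  qed (use \<phi>(1) laplacian_cochain[OF Y ori] cochains_linear[of \<phi> Y k \<phi> c 0] in auto)
  moreover have "\<phi> \<noteq> (\<lambda>_. 0)" using \<phi>(1) by (auto simp: cochain_inner_def)
  ultimately have ev: "laplacian_eigenvalue ori Y k c"
    using \<phi>(1) by (auto simp: laplacian_eigenvalue_def)
  have least: "c \<le> c'" if c': "laplacian_eigenvalue ori Y k c'" for c'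
  proof -
    obtain \<psi> where \<psi>: "\<psi> \<in> cochains Y k" "\<psi> \<noteq> (\<lambda>_. 0)" "laplacian ori Y k \<psi> = (\<lambda>xs. c' * \<psi> xs + 0 * \<psi> xs)"
      using c' by (auto simp: laplacian_eigenvalue_def)
    have "?D \<psi> \<psi> = c' * ?N \<psi> \<psi>"
      using cochain_inner_laplacian[OF Y ori \<psi>(1) \<psi>(1)] unfolding \<psi>(3) cochain_inner_linear by simp
    then have "c * ?N \<psi> \<psi> \<le> c' * ?N \<psi> \<psi>" using rayleigh[OF \<psi>(1)] by simp
    moreover have "?N \<psi> \<psi> > 0"
      using cochain_inner_nonneg[of ori Y k \<psi>] cochain_inner_self_eq_0[OF Y ori \<psi>(1)] \<psi>(2) by fastforce
    ultimately show ?thesis by simp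
  qed
  have "min_eigenvalue ori Y k = c"
    unfolding min_eigenvalue_def by (rule Least_equality) (use ev least in auto)
  then show thesis
    using that[of \<phi>] \<phi>(1) rayleigh by (simp add: c_def)
qed

section \<open>Extending cochains of a subcomplex by zero\<close>

lemma ordered_simplices_mono: "subcomplex X' X \<Longrightarrow> ordered_simplices X' k \<subseteq> ordered_simplices X k"
  by (auto simp: subcomplex_def ordered_simplices_def simplices_def)

lemma simplices_mono: "subcomplex X' X \<Longrightarrow> simplices X' k \<subseteq> simplices X k"
  by (auto simp: subcomplex_def simplices_def)

lemma cochains_extend_by_zero:
  assumes "subcomplex X' X" and \<phi>: "\<phi> \<in> cochains X' k"
  shows "\<phi> \<in> cochains X k"
proof (rule cochainsI)
  show "\<phi> xs = 0" if "xs \<notin> ordered_simplices X k" for xs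
    using that ordered_simplices_mono[OF assms(1)] cochains_outside[OF \<phi>] by blast
qed (auto intro: cochains_reorder[OF \<phi>])

lemma cochain_inner_extend_by_zero:
  assumes X: "simplicial_complex X" and X': "subcomplex X' X" and ori: "orientation X ori"
    and \<phi>: "\<phi> \<in> cochains X' k"
  shows "cochain_inner ori X k \<phi> \<psi> = cochain_inner ori X' k \<phi> \<psi>"
  unfolding cochain_inner_def
proof (rule sum.mono_neutral_right[OF finite_simplices[OF X] simplices_mono[OF X']], rule ballI)
  fix \<sigma> assume "\<sigma> \<in> simplices X k - simplices X' k"
  then have "ori \<sigma> \<notin> ordered_simplices X' k"
    using orientation_simplex(2)[OF ori, of \<sigma> k] by (auto simp: ordered_simplices_def)
  then show "\<phi> (ori \<sigma>) * \<psi> (ori \<sigma>) = 0"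
    using cochains_outside[OF \<phi>] by simp
qed

text \<open>
If \<open>\<psi>\<close> is nonzero at \<open>v # xs\<close>, then \<open>v # xs\<close> orders a simplex of \<open>X'\<close>, and so does its face \<open>xs\<close>,
because \<open>X'\<close> is closed under taking faces. Thus nothing is added outside \<open>X'\<close>.
\<close>

lemma coboundary_transpose_extend_by_zero:
  assumes X: "simplicial_complex X" and X': "subcomplex X' X" and \<psi>: "\<psi> \<in> cochains X' (k + 1)"
  shows "coboundary_transpose X k \<psi> = coboundary_transpose X' k \<psi>"
proof
  fix xs
  have sc: "simplicial_complex X'" using X' by (simp add: subcomplex_def)
  have z: "\<psi> (v # xs) = 0" if "xs \<notin> ordered_simplices X' k \<or> v \<notin> \<Union>X'" for v
  proof (rule cochains_outside[OF \<psi>], rule notI)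
    assume "v # xs \<in> ordered_simplices X' (k + 1)"
    then have "distinct xs" "v \<notin> set xs" "insert v (set xs) \<in> simplices X' (k + 1)"
      by (auto simp: ordered_simplices_def)
    then show False
      using facet_of_simplex[OF sc, of v "set xs" k] that by (auto simp: ordered_simplices_def)
  qed
  show "coboundary_transpose X k \<psi> xs = coboundary_transpose X' k \<psi> xs"
  proof (cases "xs \<in> ordered_simplices X' k")
    case True
    have "\<Union>X' \<subseteq> \<Union>X" using X' by (auto simp: subcomplex_def)
    then have "(\<Sum>v\<in>\<Union>X. \<psi> (v # xs)) = (\<Sum>v\<in>\<Union>X'. \<psi> (v # xs))"
      using finite_vertices[OF X] z by (intro sum.mono_neutral_right) auto
    then show ?thesis
      using True ordered_simplices_mono[OF X'] by (auto simp: coboundary_transpose_def)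
  next
    case False
    then show ?thesis using z by (simp add: coboundary_transpose_def)
  qed
qed

text \<open>
The coboundary at \<open>\<tau>\<close> is a signed sum of the values of \<open>\<phi>\<close> on the facets of \<open>\<tau>\<close>, of which there are
\<open>k + 2\<close>; the bound is the Cauchy-Schwarz inequality.
\<close>

lemma coboundary_square_le:
  assumes Y: "simplicial_complex Y" and ori: "orientation Y ori"
    and \<phi>: "\<phi> \<in> cochains Y k" and \<tau>: "\<tau> \<in> simplices Y (k + 1)"
  shows "(coboundary Y k \<phi> (ori \<tau>))\<^sup>2 \<le> (of_int k + 2) * (\<Sum>\<sigma> | \<sigma> \<in> simplices Y k \<and> \<sigma> \<subset> \<tau>. (\<phi> (ori \<sigma>))\<^sup>2)"
proof -
  note o = orientation_simplex[OF ori]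
  let ?t = "ori \<tau>"
  let ?a = "\<lambda>v. of_int (list_sign ?t (v # remove1 v ?t)) * \<phi> (remove1 v ?t)"
  have card: "real (card \<tau>) = of_int k + 2"
    using \<tau> by (auto simp: simplices_def)
  have "(coboundary Y k \<phi> ?t)\<^sup>2 = (\<Sum>v\<in>\<tau>. ?a v)\<^sup>2"
    using coboundary_eq_sum_vertices[OF o(3)[OF \<tau>]] o(2)[OF \<tau>] by simp
  also have "\<dots> \<le> (\<Sum>v\<in>\<tau>. (?a v)\<^sup>2) * card \<tau>"
    by (rule sum_squared_le_sum_of_squares)
  also have "(\<Sum>v\<in>\<tau>. (?a v)\<^sup>2) = (\<Sum>v\<in>\<tau>. (\<phi> (ori (\<tau> - {v})))\<^sup>2)"
  proof (rule sum.cong)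
    fix v assume v: "v \<in> \<tau>"
    let ?s = "ori (\<tau> - {v})"
    have "\<phi> (remove1 v ?t) = of_int (list_sign ?s (remove1 v ?t)) * \<phi> ?s"
      using o(1,2)[OF \<tau>] o(1,2)[OF facet_simplex[OF Y \<tau> v]] by (intro cochains_reorder[OF \<phi>]) auto
    then show "(?a v)\<^sup>2 = (\<phi> ?s)\<^sup>2"
      by (simp add: power_mult_distrib list_sign_def sign_def)
  qed simp
  also have "\<dots> = (\<Sum>\<sigma>\<in>(\<lambda>v. \<tau> - {v}) ` \<tau>. (\<phi> (ori \<sigma>))\<^sup>2)"
    by (subst sum.reindex) (auto simp: inj_on_def)
  also have "\<dots> * card \<tau> \<le> (\<Sum>\<sigma> | \<sigma> \<in> simplices Y k \<and> \<sigma> \<subset> \<tau>. (\<phi> (ori \<sigma>))\<^sup>2) * card \<tau>"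
    using facet_simplex[OF Y \<tau>] finite_simplices[OF Y] by (intro mult_right_mono sum_mono2) auto
  finally show ?thesis
    by (simp only: card mult.commute)
qed

text \<open>
Only the \<open>(k+1)\<close>-simplices of \<open>X\<close> outside \<open>X'\<close> increase the form, and a double count bounds their
total contribution: a \<open>k\<close>-simplex \<open>\<sigma>\<close> enters once for each missing coface.
\<close>

lemma dirichlet_form_extend_by_zero:
  assumes X: "simplicial_complex X" and X': "subcomplex X' X" and ori: "orientation X ori"
    and \<phi>: "\<phi> \<in> cochains X' k" and ne: "simplices X' k \<noteq> {}"
  shows "dirichlet_form ori X k \<phi> \<phi> \<le> dirichlet_form ori X' k \<phi> \<phi> +
    (of_int k + 2) * real (max_missing_cofaces k X X') * cochain_inner ori X' k \<phi> \<phi>"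
proof -
  let ?M = "simplices X (k + 1) - simplices X' (k + 1)"
  let ?f = "\<lambda>\<sigma>. (\<phi> (ori \<sigma>))\<^sup>2"
  let ?n = "\<lambda>\<sigma>. card {\<tau> \<in> ?M. \<sigma> \<subset> \<tau>}"
  note o = orientation_simplex[OF ori]
  have sc: "simplicial_complex X'" using X' by (simp add: subcomplex_def)
  \<comment> \<open>A simplex of dimension \<open>k\<close> forces \<open>k \<ge> -1\<close>.\<close>
  have k: "of_int k + 2 \<ge> (0 :: real)"
    using ne by (auto simp: simplices_def)
  have \<phi>0: "\<phi> (ori \<sigma>) = 0" if "\<sigma> \<in> simplices X k - simplices X' k" for \<sigma>
    using that o(2)[of \<sigma> k] by (intro cochains_outside[OF \<phi>]) (auto simp: ordered_simplices_def)
  \<comment> \<open>The part of the form that involves \<open>\<delta>\<^sup>*\<close> is the same in both complexes.\<close>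
  have lower: "cochain_inner ori X (k - 1) (coboundary_transpose X (k - 1) \<phi>) (coboundary_transpose X (k - 1) \<phi>) =
      cochain_inner ori X' (k - 1) (coboundary_transpose X' (k - 1) \<phi>) (coboundary_transpose X' (k - 1) \<phi>)"
    using coboundary_transpose_extend_by_zero[OF X X', of \<phi> "k - 1"] \<phi>
      cochain_inner_extend_by_zero[OF X X' ori coboundary_transpose_cochain[of \<phi> X' "k - 1"]]
    by simp
  have "cochain_inner ori X (k + 1) (coboundary X k \<phi>) (coboundary X k \<phi>) =
      (\<Sum>\<tau>\<in>?M. (coboundary X k \<phi> (ori \<tau>))\<^sup>2) + (\<Sum>\<tau>\<in>simplices X' (k + 1). (coboundary X k \<phi> (ori \<tau>))\<^sup>2)"
    unfolding cochain_inner_def power2_eq_square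
    by (rule sum.subset_diff[OF simplices_mono[OF X'] finite_simplices[OF X]])
  also have "(\<Sum>\<tau>\<in>simplices X' (k + 1). (coboundary X k \<phi> (ori \<tau>))\<^sup>2) =
      cochain_inner ori X' (k + 1) (coboundary X' k \<phi>) (coboundary X' k \<phi>)"
    unfolding cochain_inner_def
  proof (rule sum.cong)
    fix \<tau> assume \<tau>: "\<tau> \<in> simplices X' (k + 1)"
    then have \<tau>X: "\<tau> \<in> simplices X (k + 1)" using simplices_mono[OF X'] by blast
    have "ori \<tau> \<in> ordered_simplices X' (k + 1)"
      using \<tau> o(1,2)[OF \<tau>X] by (simp add: ordered_simplices_def)
    then show "(coboundary X k \<phi> (ori \<tau>))\<^sup>2 = coboundary X' k \<phi> (ori \<tau>) * coboundary X' k \<phi> (ori \<tau>)"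
      using o(3)[OF \<tau>X] by (simp add: coboundary_def power2_eq_square)
  qed simp
  also have "(\<Sum>\<tau>\<in>?M. (coboundary X k \<phi> (ori \<tau>))\<^sup>2) \<le>
      (\<Sum>\<tau>\<in>?M. (of_int k + 2) * (\<Sum>\<sigma> | \<sigma> \<in> simplices X k \<and> \<sigma> \<subset> \<tau>. ?f \<sigma>))"
    by (intro sum_mono coboundary_square_le[OF X ori cochains_extend_by_zero[OF X' \<phi>]]) auto
  also have "\<dots> = (\<Sum>\<tau>\<in>?M. (of_int k + 2) * (\<Sum>\<sigma> | \<sigma> \<in> simplices X' k \<and> \<sigma> \<subset> \<tau>. ?f \<sigma>))"
  proof (rule sum.cong[OF refl])
    fix \<tau>
    have "(\<Sum>\<sigma> | \<sigma> \<in> simplices X k \<and> \<sigma> \<subset> \<tau>. ?f \<sigma>) = (\<Sum>\<sigma> | \<sigma> \<in> simplices X' k \<and> \<sigma> \<subset> \<tau>. ?f \<sigma>)"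
      using finite_simplices[OF X] simplices_mono[OF X', of k] \<phi>0
      by (intro sum.mono_neutral_right) auto
    then show "(of_int k + 2) * (\<Sum>\<sigma> | \<sigma> \<in> simplices X k \<and> \<sigma> \<subset> \<tau>. ?f \<sigma>) =
        (of_int k + 2) * (\<Sum>\<sigma> | \<sigma> \<in> simplices X' k \<and> \<sigma> \<subset> \<tau>. ?f \<sigma>)"
      by simp
  qed
  also have "\<dots> = (of_int k + 2) * (\<Sum>\<sigma>\<in>simplices X' k. \<Sum>\<tau> | \<tau> \<in> ?M \<and> \<sigma> \<subset> \<tau>. ?f \<sigma>)"
    unfolding sum_distrib_left[symmetric]
    using finite_simplices[OF X] finite_simplices[OF sc]
    by (subst sum.swap_restrict) auto
  also have "(\<Sum>\<sigma>\<in>simplices X' k. \<Sum>\<tau> | \<tau> \<in> ?M \<and> \<sigma> \<subset> \<tau>. ?f \<sigma>) = (\<Sum>\<sigma>\<in>simplices X' k. real (?n \<sigma>) * ?f \<sigma>)"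
    by simp
  also have "\<dots> \<le> (\<Sum>\<sigma>\<in>simplices X' k. real (max_missing_cofaces k X X') * ?f \<sigma>)"
  proof (rule sum_mono)
    fix \<sigma> assume "\<sigma> \<in> simplices X' k"
    then have "?n \<sigma> \<le> max_missing_cofaces k X X'"
      unfolding max_missing_cofaces_def using finite_simplices[OF sc] by (intro Max_ge) auto
    then show "real (?n \<sigma>) * ?f \<sigma> \<le> real (max_missing_cofaces k X X') * ?f \<sigma>"
      by (intro mult_right_mono) auto
  qed
  also have "\<dots> = real (max_missing_cofaces k X X') * cochain_inner ori X' k \<phi> \<phi>"
    by (simp add: cochain_inner_def sum_distrib_left power2_eq_square)
  finally show ?thesis
    using lower k by (simp add: dirichlet_form_def mult_left_mono mult.assoc)
qed

text \<open>
A minimising unit cochain of \<open>X'\<close> is a test function for the Rayleigh quotient of \<open>X\<close>.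
\<close>

theorem theorem1p4:
  fixes X X' :: "'a set set" and ori :: "'a set \<Rightarrow> 'a list" and k :: int
  assumes "simplicial_complex X" and "connected_complex X"
    and "subcomplex X' X" and "connected_complex X'"
    and "orientation X ori"
    and "k \<ge> 1"
    and "simplices X' k \<noteq> {}"
  shows "min_eigenvalue ori X' k \<ge>
           min_eigenvalue ori X k - (real_of_int k + 2) * real (max_missing_cofaces k X X')"
proof -
  have X': "simplicial_complex X'" "orientation X' ori" "simplices X k \<noteq> {}"
    using assms(3,5,7) simplices_mono[OF assms(3), of k] by (auto simp: subcomplex_def orientation_def)
  obtain \<phi> where \<phi>: "\<phi> \<in> cochains X' k" "cochain_inner ori X' k \<phi> \<phi> = 1"
    "dirichlet_form ori X' k \<phi> \<phi> = min_eigenvalue ori X' k"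
    by (rule min_eigenvalue_rayleigh[OF X'(1,2) assms(7)])
  have "min_eigenvalue ori X k = min_eigenvalue ori X k * cochain_inner ori X k \<phi> \<phi>"
    using cochain_inner_extend_by_zero[OF assms(1,3,5) \<phi>(1)] \<phi>(2) by simp
  also have "\<dots> \<le> dirichlet_form ori X k \<phi> \<phi>"
    using cochains_extend_by_zero[OF assms(3) \<phi>(1)] by (rule_tac min_eigenvalue_rayleigh[OF assms(1,5) X'(3)]) blast
  also have "\<dots> \<le> min_eigenvalue ori X' k + (real_of_int k + 2) * real (max_missing_cofaces k X X')"
    using dirichlet_form_extend_by_zero[OF assms(1,3,5) \<phi>(1) assms(7)] \<phi>(2,3) by simp
  finally show ?thesis by simp
qed
end
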